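(* Let $w_1=(1,0)$, $w_2=(0,1)$, $w_3=(1,1)$, $w_4=(-1,1)$, $w_5=(2,1)$. The system of curves $w_1,\dots,w_5$ on the torus is minimal, i.e. $\mathrm{cr}(5;1)=\mathrm{cr}(w_1,\dots,w_5)=14$. Moreover, for any minimal system $v_1,\dots,v_5$ of five curves there exists $A\in\mathrm{SL}_2(\mathbb{Z})$ such that $\{Av_1,\dots,Av_5\}=\{w_1,\dots,w_5\}$, as sets of curves (vectors being identified up to sign).
   Context: Let $\Sigma_1$ be the torus. Isotopy classes of non-contractible, oriented simple closed curves on $\Sigma_1$ correspond bijectively to primitive vectors in $\mathbb{Z}^2$. Only unoriented curves are considered, so $(a,b)$ and $(-a,-b)$ represent the same curve; primitive vectors up to sign are called curves. The geometric intersection number is $i((a,b),(c,d))=|ad-bc|$. A system of $k$ curves consists of $k$ pairwise non-homotopic curves, i.e. primitive vectors $v_1,\dots,v_k\in\mathbb{Z}^2$ with $v_i\ne\pm v_j$ for $i\neq j$. Its crossing number is $\mathrm{cr}(v_1,\dots,v_k)=\sum_{1\le i<j\le k}i(v_i,v_j)$; $\mathrm{cr}(k;1)$ is the minimum of the crossing number over all systems of $k$ curves on the torus, and a system attaining it is called minimal. $\mathrm{SL}_2(\mathbb{Z})$ (the mapping class group of the torus) acts on $\mathbb{Z}^2$ by left multiplication on column vectors. *)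

theory Defs
  imports "HOL-Analysis.Analysis"
begin

definition primitive :: "int^2 \<Rightarrow> bool" where
  "primitive v \<longleftrightarrow> coprime (v $ 1) (v $ 2)"

text \<open>The unoriented curve represented by a primitive vector: the vector up to sign.\<close>

definition curve :: "int^2 \<Rightarrow> (int^2) set" where
  "curve v = {v, - v}"

definition inter :: "int^2 \<Rightarrow> int^2 \<Rightarrow> nat" where
  "inter u v = nat \<bar>u $ 1 * v $ 2 - u $ 2 * v $ 1\<bar>"

text \<open>A system of \<open>k\<close> curves is a list of \<open>k\<close> representing primitive vectors
  (the choice of signs is immaterial); the entries are numbered from 0.\<close>

definition curve_system :: "nat \<Rightarrow> (int^2) list \<Rightarrow> bool" where
  "curve_system k vs \<longleftrightarrow> length vs = k \<and> (\<forall>v\<in>set vs. primitive v) \<and>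
     (\<forall>i<k. \<forall>j<k. i \<noteq> j \<longrightarrow> vs ! i \<noteq> vs ! j \<and> vs ! i \<noteq> - (vs ! j))"

definition cr :: "(int^2) list \<Rightarrow> nat" where
  "cr vs = (\<Sum>j<length vs. \<Sum>i<j. inter (vs ! i) (vs ! j))"

text \<open>The number \<open>cr(k;1)\<close>. There are infinitely many curves, so systems of \<open>k\<close> curves
  exist for every \<open>k\<close> and the minimum is attained.\<close>

definition min_cr :: "nat \<Rightarrow> nat" where
  "min_cr k = (LEAST n. \<exists>vs. curve_system k vs \<and> cr vs = n)"

definition minimal_system :: "nat \<Rightarrow> (int^2) list \<Rightarrow> bool" where
  "minimal_system k vs \<longleftrightarrow> curve_system k vs \<and> cr vs = min_cr k"

definition SL2Z :: "(int^2^2) set" where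
  "SL2Z = {A. det A = 1}"

definition ws :: "(int^2) list" where
  "ws = [vector [1, 0], vector [0, 1], vector [1, 1], vector [-1, 1], vector [2, 1]]"

end

theory Submission
  imports Defs
begin

text \<open>In a system of five curves with crossing number at most 14, the ten intersection numbers
  count twice in the five row sums, so some curve \<open>u\<close> has total intersection at most 5 with the
  other four. These intersections are positive, hence at least three of them are 1 and the last is
  1 or 2. Moving \<open>u\<close> to \<open>(1,0)\<close> by a Bezout matrix, the others become \<open>(a,1)\<close>, \<open>(b,1)\<close>, \<open>(c,1)\<close>
  and \<open>(p,q)\<close> with \<open>q \<in> {1,2}\<close>, and an elementary estimate leaves only consecutive integers
  \<open>a, b, c, p\<close> (if \<open>q = 1\<close>), or consecutive \<open>a, b, c\<close> with \<open>p / 2\<close> midway between two neighbours among them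
  (if \<open>q = 2\<close>). All of these are equivalent to the fan \<open>w\<^sub>1, \<dots>, w\<^sub>5\<close> in the Farey graph.\<close>

section \<open>Curves, intersection numbers and the action of \<open>SL2Z\<close>\<close>

lemma vec2_eq_iff: "u = v \<longleftrightarrow> u $ 1 = v $ 1 \<and> u $ 2 = v $ (2::2)"
  by (simp add: vec_eq_iff forall_2)

lemma matrix_vector_mult_2:
  fixes A :: "int^2^2"
  shows "(A *v v) $ 1 = A $ 1 $ 1 * v $ 1 + A $ 1 $ 2 * v $ 2"
    and "(A *v v) $ 2 = A $ 2 $ 1 * v $ 1 + A $ 2 $ 2 * v $ 2"
  by (simp_all add: matrix_vector_mult_def sum_2)

lemma matrix_vector_mult_minus:
  fixes A :: "int^2^2"
  shows "A *v (- v) = - (A *v v)"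
  by (simp add: vec2_eq_iff matrix_vector_mult_2)

lemma curve_eq_iff: "curve u = curve v \<longleftrightarrow> u = v \<or> u = - v"
  by (auto simp: curve_def doubleton_eq_iff)

lemma inter_commute: "inter u v = inter v u"
  by (simp add: inter_def abs_minus_commute mult.commute)

lemma inter_self [simp]: "inter u u = 0"
  by (simp add: inter_def)

lemma inter_minus [simp]: "inter (- u) v = inter u v" "inter u (- v) = inter u v"
  by (simp_all add: inter_def abs_minus_commute)

lemma inter_vector: "inter (vector [a, b]) (vector [c, d]) = nat \<bar>a * d - b * c\<bar>"
  by (simp add: inter_def)

lemma inter_curve_cong:
  assumes "curve u = curve u'" "curve v = curve v'"
  shows "inter u v = inter u' v'"
  using assms by (auto simp: curve_eq_iff)

lemma inter_SL2Z:
  assumes "A \<in> SL2Z"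
  shows "inter (A *v u) (A *v v) = inter u v"
proof -
  have "(A *v u) $ 1 * (A *v v) $ 2 - (A *v u) $ 2 * (A *v v) $ 1
      = det A * (u $ 1 * v $ 2 - u $ 2 * v $ 1)"
    by (simp add: matrix_vector_mult_2 det_2 algebra_simps)
  with assms show ?thesis by (simp add: inter_def SL2Z_def)
qed

lemma primitive_SL2Z:
  assumes "A \<in> SL2Z" "primitive v"
  shows "primitive (A *v v)"
  unfolding primitive_def
proof (rule coprimeI)
  fix d assume d: "d dvd (A *v v) $ 1" "d dvd (A *v v) $ 2"
  have det: "A $ 1 $ 1 * A $ 2 $ 2 - A $ 1 $ 2 * A $ 2 $ 1 = 1"
    using assms(1) by (simp add: SL2Z_def det_2)
  \<comment> \<open>The adjugate of \<open>A\<close> recovers \<open>v\<close> from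
    \<open>A *v v\<close>, so a common divisor of the image coordinates divides those of
    \<open>v\<close>.\<close>
  have "v $ 1 = (A $ 1 $ 1 * A $ 2 $ 2 - A $ 1 $ 2 * A $ 2 $ 1) * v $ 1"
    using det by simp
  also have "\<dots> = A $ 2 $ 2 * (A *v v) $ 1 - A $ 1 $ 2 * (A *v v) $ 2"
    by (simp add: matrix_vector_mult_2 algebra_simps)
  finally have 1: "d dvd v $ 1" using d by simp
  have "v $ 2 = (A $ 1 $ 1 * A $ 2 $ 2 - A $ 1 $ 2 * A $ 2 $ 1) * v $ 2"
    using det by simp
  also have "\<dots> = A $ 1 $ 1 * (A *v v) $ 2 - A $ 2 $ 1 * (A *v v) $ 1"
    by (simp add: matrix_vector_mult_2 algebra_simps)
  finally have "d dvd v $ 2" using d by simp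
  with 1 assms(2) show "is_unit d" by (auto simp: primitive_def coprime_def)
qed

text \<open>A vanishing determinant makes the vectors proportional; coprimality then fixes the
  coordinates up to sign, and the vanishing itself ties the two signs together.\<close>

lemma inter_pos:
  assumes "primitive u" "primitive v" "curve u \<noteq> curve v"
  shows "inter u v > 0"
proof (rule ccontr)
  assume "\<not> inter u v > 0"
  hence eq: "u $ 1 * v $ 2 = u $ 2 * v $ 1" by (simp add: inter_def)
  hence "\<bar>u $ 1\<bar> * \<bar>v $ 2\<bar> = \<bar>v $ 1\<bar> * \<bar>u $ 2\<bar>"
    by (metis abs_mult mult.commute)
  hence "\<bar>u $ 1\<bar> = \<bar>v $ 1\<bar>" "\<bar>v $ 2\<bar> = \<bar>u $ 2\<bar>"
    using coprime_crossproduct_int[of "u $ 1" "u $ 2" "v $ 1" "v $ 2"] assms(1,2)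
    by (simp_all add: primitive_def coprime_commute)
  with eq have "u = v \<or> u = - v"
    by (auto simp: vec2_eq_iff abs_eq_iff)
  with assms(3) show False by (simp add: curve_eq_iff)
qed

lemma primitive_to_horizontal:
  assumes "primitive u"
  obtains A where "A \<in> SL2Z" "A *v u = vector [1, 0]"
proof -
  obtain x y where xy: "x * u $ 1 + y * u $ 2 = 1"
    using assms bezout_int[of "u $ 1" "u $ 2"] by (auto simp: primitive_def)
  \<comment> \<open>The second row annihilates \<open>u\<close>, and the determinant is the Bezout
    sum.\<close>
  define A :: "int^2^2" where "A = vector [vector [x, y], vector [- u $ 2, u $ 1]]"
  have "A \<in> SL2Z" "A *v u = vector [1, 0]"
    using xy by (simp_all add: SL2Z_def det_2 A_def vec2_eq_iff matrix_vector_mult_2 algebra_simps)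
  thus thesis by (rule that)
qed

text \<open>Intersecting with the horizontal curve reads off the absolute height; the free sign
  makes the height nonnegative.\<close>

lemma curve_normal_form:
  assumes "inter (vector [1, 0]) v = q"
  obtains p where "curve v = curve (vector [p, int q])"
proof (cases "v $ 2 \<ge> 0")
  case True
  have "v = vector [v $ 1, int q]" using True assms by (auto simp: inter_def vec2_eq_iff)
  thus thesis by (metis that)
next
  case False
  have "v = - vector [- v $ 1, int q]" using False assms by (auto simp: inter_def vec2_eq_iff)
  thus thesis by (metis that curve_eq_iff)
qed

section \<open>Equivalence of sets of curves\<close>

definition SL2Z_equiv :: "(int^2) set \<Rightarrow> (int^2) set \<Rightarrow> bool" where
  "SL2Z_equiv S T \<longleftrightarrow> (\<exists>A\<in>SL2Z. (\<lambda>v. curve (A *v v)) ` S = curve ` T)"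

lemma SL2Z_equiv_trans:
  assumes "SL2Z_equiv S T" "SL2Z_equiv T U"
  shows "SL2Z_equiv S U"
proof -
  obtain A B where A: "A \<in> SL2Z" "(\<lambda>v. curve (A *v v)) ` S = curve ` T"
    and B: "B \<in> SL2Z" "(\<lambda>v. curve (B *v v)) ` T = curve ` U"
    using assms by (auto simp: SL2Z_equiv_def)
  \<comment> \<open>Multiplication by \<open>B\<close> commutes with negation, so it acts on curves
    as sets and can be applied to both sides of the equation for \<open>A\<close>.\<close>
  have im: "curve (B *v v) = (\<lambda>w. B *v w) ` curve v" for v
    by (simp add: curve_def matrix_vector_mult_minus)
  have "(\<lambda>v. curve ((B ** A) *v v)) ` S = (\<lambda>c. (\<lambda>w. B *v w) ` c) ` (\<lambda>v. curve (A *v v)) ` S"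
    by (simp add: image_image im flip: matrix_vector_mul_assoc)
  also have "\<dots> = curve ` U" using A(2) B(2) by (simp add: image_image im)
  finally have "(\<lambda>v. curve ((B ** A) *v v)) ` S = curve ` U" .
  moreover have "B ** A \<in> SL2Z" using A(1) B(1) by (simp add: SL2Z_def det_mul)
  ultimately show ?thesis unfolding SL2Z_equiv_def by blast
qed

section \<open>Extremal configurations of integers\<close>

text \<open>With successive gaps \<open>g\<close>, \<open>h\<close>, \<open>k\<close> of the sorted
  integers the sum is \<open>3 * g + 4 * h + 3 * k\<close>, which is at least 10 with equality only
  for unit gaps.\<close>

lemma four_ints_close:
  fixes a b c d :: int
  assumes "distinct [a, b, c, d]"
    and "\<bar>a - b\<bar> + \<bar>a - c\<bar> + \<bar>a - d\<bar> + \<bar>b - c\<bar> + \<bar>b - d\<bar> + \<bar>c - d\<bar> \<le> 10"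
  obtains m where "{a, b, c, d} = {m, m + 1, m + 2, m + 3}"
    and "\<bar>a - b\<bar> + \<bar>a - c\<bar> + \<bar>a - d\<bar> + \<bar>b - c\<bar> + \<bar>b - d\<bar> + \<bar>c - d\<bar> = 10"
proof -
  define m where "m = min (min a b) (min c d)"
  have le: "m \<le> a" "m \<le> b" "m \<le> c" "m \<le> d" by (simp_all add: m_def)
  have m: "m = a \<or> m = b \<or> m = c \<or> m = d" by (auto simp: m_def min_def)
  have neq: "a \<noteq> b" "a \<noteq> c" "a \<noteq> d" "b \<noteq> c" "b \<noteq> d" "c \<noteq> d" using assms(1) by auto
  have sub: "a \<le> m + 3" "b \<le> m + 3" "c \<le> m + 3" "d \<le> m + 3"
    and eq: "\<bar>a - b\<bar> + \<bar>a - c\<bar> + \<bar>a - d\<bar> + \<bar>b - c\<bar> + \<bar>b - d\<bar> + \<bar>c - d\<bar> = 10"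
    using le m neq assms(2) by (smt (verit))+
  have "{a, b, c, d} \<subseteq> {m..m + 3}" using le sub by auto
  moreover have "card {a, b, c, d} = card {m..m + 3}" using neq by simp
  ultimately have "{a, b, c, d} = {m..m + 3}" by (intro card_subset_eq) auto
  also have "\<dots> = {m, m + 1, m + 2, m + 3}" by auto
  finally show thesis using eq by (rule that)
qed

text \<open>The mutual distances sum to twice the spread, hence to at least 4. The distances from
  \<open>p\<close> to three distinct even numbers are odd and at most two of them are 1, so they sum
  to at least 5.\<close>

lemma three_ints_close:
  fixes a b c p :: int
  assumes "distinct [a, b, c]" "odd p"
    and "\<bar>a - b\<bar> + \<bar>a - c\<bar> + \<bar>b - c\<bar> + \<bar>2 * a - p\<bar> + \<bar>2 * b - p\<bar> + \<bar>2 * c - p\<bar> \<le> 9"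
  obtains m where "{a, b, c} = {m, m + 1, m + 2}" "p = 2 * m + 1 \<or> p = 2 * m + 3"
    and "\<bar>a - b\<bar> + \<bar>a - c\<bar> + \<bar>b - c\<bar> + \<bar>2 * a - p\<bar> + \<bar>2 * b - p\<bar> + \<bar>2 * c - p\<bar> = 9"
proof -
  define m where "m = min a (min b c)"
  have le: "m \<le> a" "m \<le> b" "m \<le> c" by (simp_all add: m_def)
  have m: "m = a \<or> m = b \<or> m = c" by (auto simp: m_def min_def)
  have neq: "a \<noteq> b" "a \<noteq> c" "b \<noteq> c" using assms(1) by auto
  \<comment> \<open>Parity is essential: for consecutive \<open>a, b, c\<close> the even value
    \<open>2 * (m + 1)\<close> would lower the total to 8.\<close>
  have par: "p \<noteq> 2 * a" "p \<noteq> 2 * b" "p \<noteq> 2 * c" "p \<noteq> 2 * (m + 1)" using assms(2) by auto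
  have sub: "a \<le> m + 2" "b \<le> m + 2" "c \<le> m + 2"
    and p: "p = 2 * m + 1 \<or> p = 2 * m + 3"
    and eq: "\<bar>a - b\<bar> + \<bar>a - c\<bar> + \<bar>b - c\<bar> + \<bar>2 * a - p\<bar> + \<bar>2 * b - p\<bar> + \<bar>2 * c - p\<bar> = 9"
    using le m neq par assms(3) by (smt (verit))+
  have "{a, b, c} \<subseteq> {m..m + 2}" using le sub by auto
  moreover have "card {a, b, c} = card {m..m + 2}" using neq by simp
  ultimately have "{a, b, c} = {m..m + 2}" by (intro card_subset_eq) auto
  also have "\<dots> = {m, m + 1, m + 2}" by auto
  finally show thesis using p eq by (rule that)
qed

section \<open>Matching the normal forms with \<open>ws\<close>\<close>

lemma set_ws: "set ws = {vector [1, 0], vector [0, 1], vector [1, 1], vector [-1, 1], vector [2, 1]}"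
  by (simp add: ws_def)

lemma fan_equiv_ws:
  "SL2Z_equiv {vector [1, 0], vector [m, 1], vector [m + 1, 1], vector [m + 2, 1], vector [m + 3, 1]}
     (set ws)"
proof -
  \<comment> \<open>This shear fixes the horizontal curve and translates the vectors of height 1 by
    \<open>- (m + 1)\<close>.\<close>
  define A :: "int^2^2" where "A = vector [vector [1, - m - 1], vector [0, 1]]"
  have "A \<in> SL2Z" by (simp add: A_def SL2Z_def det_2)
  moreover have "A *v vector [1, 0] = vector [1, 0]" "A *v vector [m, 1] = vector [-1, 1]"
    "A *v vector [m + 1, 1] = vector [0, 1]" "A *v vector [m + 2, 1] = vector [1, 1]"
    "A *v vector [m + 3, 1] = vector [2, 1]"
    by (simp_all add: A_def vec2_eq_iff matrix_vector_mult_2)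
  ultimately show ?thesis
    unfolding SL2Z_equiv_def by (intro bexI[of _ A]) (simp_all add: set_ws insert_commute)
qed

text \<open>Both systems are fans around \<open>(m + 1, 1)\<close>, which the matrices in the proof send to \<open>(1, 0)\<close>.\<close>

lemma half_integer_equiv_ws:
  assumes "p = 2 * m + 1 \<or> p = 2 * m + 3"
  shows "SL2Z_equiv {vector [1, 0], vector [m, 1], vector [m + 1, 1], vector [m + 2, 1], vector [p, 2]}
     (set ws)"
  using assms
proof
  assume p: "p = 2 * m + 1"
  define A :: "int^2^2" where "A = vector [vector [0, 1], vector [-1, m + 1]]"
  have "A \<in> SL2Z" by (simp add: A_def SL2Z_def det_2)
  moreover have "A *v vector [1, 0] = - vector [0, 1]" "A *v vector [m, 1] = vector [1, 1]"
    "A *v vector [m + 1, 1] = vector [1, 0]" "A *v vector [m + 2, 1] = - vector [-1, 1]"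
    "A *v vector [p, 2] = vector [2, 1]"
    by (simp_all add: A_def vec2_eq_iff matrix_vector_mult_2 p)
  moreover have "curve (- v) = curve v" for v by (simp add: curve_eq_iff)
  ultimately show ?thesis
    unfolding SL2Z_equiv_def by (intro bexI[of _ A]) (simp_all add: set_ws insert_commute)
next
  assume p: "p = 2 * m + 3"
  define A :: "int^2^2" where "A = vector [vector [-1, m + 2], vector [-1, m + 1]]"
  have "A \<in> SL2Z" by (simp add: A_def SL2Z_def det_2)
  moreover have "A *v vector [1, 0] = - vector [1, 1]" "A *v vector [m, 1] = vector [2, 1]"
    "A *v vector [m + 1, 1] = vector [1, 0]" "A *v vector [m + 2, 1] = - vector [0, 1]"
    "A *v vector [p, 2] = - vector [-1, 1]"
    by (simp_all add: A_def vec2_eq_iff matrix_vector_mult_2 p)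
  moreover have "curve (- v) = curve v" for v by (simp add: curve_eq_iff)
  ultimately show ?thesis
    unfolding SL2Z_equiv_def by (intro bexI[of _ A]) (simp_all add: set_ws insert_commute)
qed

section \<open>Counting and rigidity\<close>

text \<open>The intersection matrix is symmetric with zero diagonal. This form forgets the order of
  the list and exposes the row sums.\<close>

lemma cr_double_sum:
  assumes "distinct vs"
  shows "(\<Sum>u\<in>set vs. \<Sum>v\<in>set vs. inter u v) = 2 * cr vs"
proof -
  have *: "(\<Sum>j<n. \<Sum>i<n. inter (vs ! i) (vs ! j)) = 2 * (\<Sum>j<n. \<Sum>i<j. inter (vs ! i) (vs ! j))" for n
  proof (induction n)
    case (Suc n)
    have "(\<Sum>j<n. inter (vs ! n) (vs ! j)) = (\<Sum>i<n. inter (vs ! i) (vs ! n))"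
      by (simp add: inter_commute)
    with Suc show ?case by (simp add: sum.distrib)
  qed simp
  have "bij_betw ((!) vs) {..<length vs} (set vs)"
    using assms by (simp add: bij_betw_nth)
  hence "(\<Sum>u\<in>set vs. f u) = (\<Sum>i<length vs. f (vs ! i))" for f :: "int^2 \<Rightarrow> nat"
    by (simp add: sum.reindex_bij_betw)
  thus ?thesis using *[of "length vs"] by (simp add: cr_def inter_commute)
qed

lemma small_row_exists:
  fixes f :: "'a \<Rightarrow> nat"
  assumes "card T = 4" "\<And>v. v \<in> T \<Longrightarrow> f v > 0" "(\<Sum>v\<in>T. f v) \<le> 5"
  obtains a b c d where "T = {a, b, c, d}" "distinct [a, b, c, d]"
    "f a = 1" "f b = 1" "f c = 1" "f d = 1 \<or> f d = 2"
proof -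
  have fin: "finite T" "T \<noteq> {}" using assms(1) by (auto intro: card_ge_0_finite)
  \<comment> \<open>Four positive values with sum at most 5 exceed 1 in total by at most one; taking
    \<open>d\<close> maximal puts this excess at \<open>d\<close>.\<close>
  have "Max (f ` T) \<in> f ` T" using fin by (intro Max_in) auto
  then obtain d where "d \<in> T" "f d = Max (f ` T)" by force
  with fin have d: "d \<in> T" "\<And>v. v \<in> T \<Longrightarrow> f v \<le> f d" by simp_all
  have "card (T - {d}) = 3" using d assms(1) fin by simp
  then obtain a b c where abc: "T - {d} = {a, b, c}" "distinct [a, b, c]"
    by (auto simp: card_Suc_eq numeral_eq_Suc)
  have T: "T = {a, b, c, d}" using abc(1) d(1) by auto
  have dist: "distinct [a, b, c, d]" using abc by auto
  have "f a + f b + f c + f d \<le> 5" using assms(3) dist by (simp add: T)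
  moreover have "f a > 0" "f b > 0" "f c > 0" "f a \<le> f d" "f b \<le> f d" "f c \<le> f d"
    using assms(2) d(2) by (auto simp: T)
  ultimately have "f a = 1 \<and> f b = 1 \<and> f c = 1 \<and> (f d = 1 \<or> f d = 2)" by linarith
  with T dist show thesis by (intro that) auto
qed

lemma five_curves_rigidity:
  assumes "card S = 5" and prim: "\<And>v. v \<in> S \<Longrightarrow> primitive v" and inj: "inj_on curve S"
    and le: "(\<Sum>u\<in>S. \<Sum>v\<in>S. inter u v) \<le> 28"
  shows "(\<Sum>u\<in>S. \<Sum>v\<in>S. inter u v) = 28 \<and> SL2Z_equiv S (set ws)"
proof -
  have fin: "finite S" using assms(1) by (auto intro: card_ge_0_finite)
  have "\<exists>u\<in>S. (\<Sum>v\<in>S. inter u v) \<le> 5"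
  proof (rule ccontr)
    assume "\<not> ?thesis"
    \<comment> \<open>Five rows of at least 6 would give 30, more than 28.\<close>
    hence "(\<Sum>u\<in>S. (6::nat)) \<le> (\<Sum>u\<in>S. \<Sum>v\<in>S. inter u v)"
      by (intro sum_mono) auto
    with le assms(1) show False by simp
  qed
  then obtain u where u: "u \<in> S" "(\<Sum>v\<in>S. inter u v) \<le> 5" by blast
  have "card (S - {u}) = 4" using u fin assms(1) by simp
  moreover have "inter u v > 0" if "v \<in> S - {u}" for v
    using that u(1) inj by (intro inter_pos prim) (auto dest: inj_onD)
  moreover have "(\<Sum>v\<in>S - {u}. inter u v) \<le> 5"
    using u fin by (simp add: sum.remove[of S u])
  ultimately obtain a b c d where abcd: "S - {u} = {a, b, c, d}" "distinct [a, b, c, d]"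
    "inter u a = 1" "inter u b = 1" "inter u c = 1" "inter u d = 1 \<or> inter u d = 2"
    by (rule small_row_exists)
  have S: "S = {u, a, b, c, d}" using abcd(1) u(1) by auto
  have dist: "distinct [u, a, b, c, d]" using abcd(1,2) by auto
  obtain A where A: "A \<in> SL2Z" "A *v u = vector [1, 0]"
    using primitive_to_horizontal prim u(1) by blast
  have row: "inter (vector [1, 0]) (A *v v) = inter u v" for v
    using inter_SL2Z[OF A(1), of u v] A(2) by simp
  define q where "q = inter u d"
  have one: "\<exists>k. curve (A *v v) = curve (vector [k, 1])" if "inter u v = 1" for v
    using curve_normal_form[OF row[of v]] that by (metis of_nat_1)
  have "\<exists>p. curve (A *v d) = curve (vector [p, int q])"
    using curve_normal_form[OF row[of d]] unfolding q_def by blast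
  with one[OF abcd(3)] one[OF abcd(4)] one[OF abcd(5)]
  obtain k l m p where klmp: "curve (A *v a) = curve (vector [k, 1])"
    "curve (A *v b) = curve (vector [l, 1])" "curve (A *v c) = curve (vector [m, 1])"
    "curve (A *v d) = curve (vector [p, int q])"
    by blast
  have equiv: "SL2Z_equiv S {vector [1, 0], vector [k, 1], vector [l, 1], vector [m, 1], vector [p, int q]}"
    using A klmp by (auto simp: SL2Z_equiv_def S intro!: bexI[of _ A])
  have inter_eq: "inter v w = inter v' w'"
    if "curve (A *v v) = curve v'" "curve (A *v w) = curve w'" for v w v' w'
    using inter_curve_cong[OF that] inter_SL2Z[OF A(1)] by simp
  have pos: "inter v w > 0" if "v \<in> S" "w \<in> S" "v \<noteq> w" for v w
    using that inj by (intro inter_pos prim) (auto dest: inj_onD)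
  have ab: "inter a b = nat \<bar>k - l\<bar>" and ac: "inter a c = nat \<bar>k - m\<bar>" and bc: "inter b c = nat \<bar>l - m\<bar>"
    and ad: "inter a d = nat \<bar>int q * k - p\<bar>" and bd: "inter b d = nat \<bar>int q * l - p\<bar>"
    and cd: "inter c d = nat \<bar>int q * m - p\<bar>"
    using inter_eq[OF klmp(1,2)] inter_eq[OF klmp(1,3)] inter_eq[OF klmp(2,3)]
      inter_eq[OF klmp(1,4)] inter_eq[OF klmp(2,4)] inter_eq[OF klmp(3,4)]
    by (simp_all add: inter_vector mult.commute)
  \<comment> \<open>Distinct curves intersect, which here says that the parameters of the normal
    form differ.\<close>
  have neq: "k \<noteq> l" "k \<noteq> m" "l \<noteq> m" "int q * k \<noteq> p" "int q * l \<noteq> p" "int q * m \<noteq> p"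
    using pos[of a b] pos[of a c] pos[of b c] pos[of a d] pos[of b d] pos[of c d] dist
    by (auto simp: S ab ac bc ad bd cd)
  define N where "N = (\<Sum>u\<in>S. \<Sum>v\<in>S. inter u v)"
  \<comment> \<open>The row of \<open>u\<close> contributes \<open>3 + q\<close>; every pair is
    counted twice.\<close>
  have tot: "N =
      2 * (3 + q + inter a b + inter a c + inter b c + inter a d + inter b d + inter c d)"
    using dist abcd(3-5) unfolding N_def S q_def
    by (simp add: inter_commute[of _ u] inter_commute[of b a] inter_commute[of c a]
        inter_commute[of c b] inter_commute[of d a] inter_commute[of d b] inter_commute[of d c])
  hence tot_int: "int N = 2 * (3 + int q + \<bar>k - l\<bar> + \<bar>k - m\<bar> + \<bar>l - m\<bar>
      + \<bar>int q * k - p\<bar> + \<bar>int q * l - p\<bar> + \<bar>int q * m - p\<bar>)"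
    unfolding ab ac bc ad bd cd by simp
  consider "q = 1" | "q = 2" using abcd(6) by (auto simp: q_def)
  thus ?thesis
  proof cases
    case 1
    have "distinct [k, l, m, p]" using neq 1 by auto
    \<comment> \<open>Half of 28, minus the 4 crossings with \<open>u\<close>, leaves 10.\<close>
    moreover have "\<bar>k - l\<bar> + \<bar>k - m\<bar> + \<bar>k - p\<bar> + \<bar>l - m\<bar> + \<bar>l - p\<bar> + \<bar>m - p\<bar> \<le> 10"
      using le[folded N_def] tot_int 1 by simp
    ultimately obtain n where n: "{k, l, m, p} = {n, n + 1, n + 2, n + 3}"
      and eq: "\<bar>k - l\<bar> + \<bar>k - m\<bar> + \<bar>k - p\<bar> + \<bar>l - m\<bar> + \<bar>l - p\<bar> + \<bar>m - p\<bar> = 10"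
      by (rule four_ints_close)
    \<comment> \<open>As an image of \<open>{k, l, m, p}\<close> the system can be rewritten by
      \<open>n\<close>, whatever the order of the parameters.\<close>
    have "{vector [1, 0], vector [k, 1], vector [l, 1], vector [m, 1], vector [p, int q]}
        = insert (vector [1, 0]) ((\<lambda>x. vector [x, 1]) ` {k, l, m, p} :: (int^2) set)"
      using 1 by simp
    with equiv fan_equiv_ws[of n] have "SL2Z_equiv S (set ws)"
      by (auto simp: n intro: SL2Z_equiv_trans)
    with eq show ?thesis using tot_int 1 unfolding N_def[symmetric] by simp
  next
    case 2
    have "distinct [k, l, m]" using neq by auto
    moreover have "odd p"
    proof -
      have "primitive (A *v d)" using A(1) prim by (intro primitive_SL2Z) (auto simp: S)
      hence "coprime p 2"
        using klmp(4) 2 by (auto simp: curve_eq_iff primitive_def)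
      thus ?thesis by simp
    qed
    \<comment> \<open>Now \<open>u\<close> accounts for 5 of the 14 crossings.\<close>
    moreover have "\<bar>k - l\<bar> + \<bar>k - m\<bar> + \<bar>l - m\<bar> + \<bar>2 * k - p\<bar> + \<bar>2 * l - p\<bar> + \<bar>2 * m - p\<bar> \<le> 9"
      using le[folded N_def] tot_int 2 by simp
    ultimately obtain n where n: "{k, l, m} = {n, n + 1, n + 2}" "p = 2 * n + 1 \<or> p = 2 * n + 3"
      and eq: "\<bar>k - l\<bar> + \<bar>k - m\<bar> + \<bar>l - m\<bar> + \<bar>2 * k - p\<bar> + \<bar>2 * l - p\<bar> + \<bar>2 * m - p\<bar> = 9"
      by (rule three_ints_close)
    have "{vector [1, 0], vector [k, 1], vector [l, 1], vector [m, 1], vector [p, int q]}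
        = {vector [1, 0], vector [p, 2]} \<union> ((\<lambda>x. vector [x, 1]) ` {k, l, m} :: (int^2) set)"
      using 2 by (simp add: insert_commute)
    also have "\<dots> = {vector [1, 0], vector [n, 1], vector [n + 1, 1], vector [n + 2, 1], vector [p, 2]}"
      unfolding n(1) by (simp add: insert_commute)
    finally have "SL2Z_equiv S (set ws)"
      using equiv half_integer_equiv_ws[OF n(2)] SL2Z_equiv_trans by simp
    with eq show ?thesis using tot_int 2 unfolding N_def[symmetric] by simp
  qed
qed

section \<open>Back to lists, and the minimum\<close>

lemma curve_system_5_rigidity:
  assumes "curve_system 5 vs" "cr vs \<le> 14"
  shows "cr vs = 14 \<and> SL2Z_equiv (set vs) (set ws)"
proof -
  have len: "length vs = 5" and prim: "\<And>v. v \<in> set vs \<Longrightarrow> primitive v"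
    and neq: "\<And>i j. i < 5 \<Longrightarrow> j < 5 \<Longrightarrow> i \<noteq> j \<Longrightarrow> curve (vs ! i) \<noteq> curve (vs ! j)"
    using assms(1) by (auto simp: curve_system_def curve_eq_iff)
  have "distinct (map curve vs)"
    using neq len by (auto simp: distinct_conv_nth)
  hence dist: "distinct vs" and inj: "inj_on curve (set vs)"
    by (simp_all add: distinct_map)
  have "card (set vs) = 5" using dist len by (simp add: distinct_card)
  from five_curves_rigidity[OF this prim inj] assms(2) show ?thesis
    by (simp add: cr_double_sum[OF dist])
qed

lemma curve_system_ws: "curve_system 5 ws"
  by (simp add: curve_system_def ws_def primitive_def eval_nat_numeral All_less_Suc vec2_eq_iff)

lemma cr_ws: "cr ws = 14"
  by (simp add: cr_def ws_def inter_def lessThan_Suc numeral_eq_Suc)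

theorem lemma4p4:
  shows "minimal_system 5 ws \<and> min_cr 5 = 14 \<and> cr ws = 14 \<and>
    (\<forall>vs. minimal_system 5 vs \<longrightarrow>
      (\<exists>A\<in>SL2Z. (\<lambda>v. curve (A *v v)) ` set vs = curve ` set ws))"
proof -
  have min: "min_cr 5 = 14"
    unfolding min_cr_def
  proof (rule Least_equality)
    show "\<exists>vs. curve_system 5 vs \<and> cr vs = 14"
      using curve_system_ws cr_ws by blast
  next
    fix n assume "\<exists>vs. curve_system 5 vs \<and> cr vs = n"
    \<comment> \<open>A system with at most 14 crossings has exactly 14, so no smaller value
      occurs.\<close>
    thus "14 \<le> n" using curve_system_5_rigidity by (metis nle_le)
  qed
  thus ?thesis
    using curve_system_ws cr_ws curve_system_5_rigidity
    by (auto simp: minimal_system_def SL2Z_equiv_def)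
qed

end
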